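(* For a topological median algebra $X$ let $\mathcal{MC}=\mathcal{MC}(X,[0,1])$ denote the family of all continuous median-preserving maps $X\to[0,1]$. (1) $\operatorname{ind}(\mathcal{MC})\le\operatorname{rank}(X)$ for every topological median algebra $X$. (2) $\operatorname{ind}(\mathcal{MC})=\operatorname{rank}(X)$ for every finite-rank compact topological median algebra $X$.
   Context: A median algebra is a set $X$ with a ternary operation $m:X^3\to X$ such that $m$ is invariant under permutations of its arguments, $m(a,b,b)=b$, and $m(m(a,x,b),x,c)=m(a,x,m(b,x,c))$ for all $a,b,c,x\in X$. A map $f:X_1\to X_2$ between median algebras is median-preserving if $f(m(x,y,z))=m(f(x),f(y),f(z))$ for all $x,y,z$. The interval $[0,1]\subset\mathbb R$ is a median algebra with $m(a,b,c)$ the middle value of $a,b,c$; $\{0,1\}^n$ carries the coordinatewise median. A topological median algebra is a Hausdorff topological space with a continuous median operation $m:X^3\to X$; it is compact if the space is compact. The rank $\operatorname{rank}(X)\in\mathbb N\cup\{\infty\}$ is the supremum of the $n\in\mathbb N$ such that $\{0,1\}^n$ embeds in $X$ as a median subalgebra. A finite sequence $f_1,\dots,f_k$ of real-valued functions on $X$ is independent if there are reals $a<b$ such that $\bigcap_{i\in P}f_i^{-1}(-\infty,a]\cap\bigcap_{j\in M}f_j^{-1}[b,\infty)\neq\varnothing$ for all disjoint $P,M\subset\{1,\dots,k\}$. For a family $\mathcal F$ of real-valued functions on $X$, the independence number $\operatorname{ind}(\mathcal F)\in\mathbb N\cup\{\infty\}$ is the supremum of the integers $k$ such that $\mathcal F$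 contains an independent sequence of length $k$. *)

theory Defs
  imports "HOL-Analysis.Analysis"
begin

(* Algebras are given by a carrier set (possibly empty), spaces by an abstract topology, so
   maps and operations only matter on the carrier.  Two transpositions generate
   all permutations of the three arguments. *)
locale median_algebra =
  fixes A :: "'a set" and m :: "'a \<Rightarrow> 'a \<Rightarrow> 'a \<Rightarrow> 'a"
  assumes closed: "\<lbrakk>a \<in> A; b \<in> A; c \<in> A\<rbrakk> \<Longrightarrow> m a b c \<in> A"
    and swap12: "\<lbrakk>a \<in> A; b \<in> A; c \<in> A\<rbrakk> \<Longrightarrow> m a b c = m b a c"
    and swap23: "\<lbrakk>a \<in> A; b \<in> A; c \<in> A\<rbrakk> \<Longrightarrow> m a b c = m a c b"
    and absorb: "\<lbrakk>a \<in> A; b \<in> A\<rbrakk> \<Longrightarrow> m a b b = b"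
    and assoc: "\<lbrakk>a \<in> A; b \<in> A; c \<in> A; x \<in> A\<rbrakk> \<Longrightarrow> m (m a x b) x c = m a x (m b x c)"

locale topological_median_algebra = median_algebra "topspace X" m
  for X :: "'a topology" and m :: "'a \<Rightarrow> 'a \<Rightarrow> 'a \<Rightarrow> 'a" +
  assumes Hausdorff: "Hausdorff_space X"
    and continuous_median:
      "continuous_map (prod_topology X (prod_topology X X)) X (\<lambda>(x, y, z). m x y z)"

definition median_preserving ::
    "'a set \<Rightarrow> ('a \<Rightarrow> 'a \<Rightarrow> 'a \<Rightarrow> 'a) \<Rightarrow> 'b set \<Rightarrow> ('b \<Rightarrow> 'b \<Rightarrow> 'b \<Rightarrow> 'b) \<Rightarrow> ('a \<Rightarrow> 'b) \<Rightarrow> bool" where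
  "median_preserving A m B m' f \<longleftrightarrow>
     f \<in> A \<rightarrow> B \<and> (\<forall>x\<in>A. \<forall>y\<in>A. \<forall>z\<in>A. f (m x y z) = m' (f x) (f y) (f z))"

definition middle :: "'a::linorder \<Rightarrow> 'a \<Rightarrow> 'a \<Rightarrow> 'a" where
  "middle a b c = max (min a b) (max (min b c) (min a c))"

lemma middle_eq: "a \<le> b \<Longrightarrow> b \<le> c \<Longrightarrow> middle a b c = b"
  by (auto simp: middle_def min_def max_def)

definition cube :: "nat \<Rightarrow> (nat \<Rightarrow> nat) set" where
  "cube n = {..<n} \<rightarrow>\<^sub>E {0, 1}"

definition cube_median ::
    "nat \<Rightarrow> (nat \<Rightarrow> nat) \<Rightarrow> (nat \<Rightarrow> nat) \<Rightarrow> (nat \<Rightarrow> nat) \<Rightarrow> (nat \<Rightarrow> nat)" where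
  "cube_median n x y z = (\<lambda>i\<in>{..<n}. middle (x i) (y i) (z i))"

definition cube_embeds :: "nat \<Rightarrow> 'a set \<Rightarrow> ('a \<Rightarrow> 'a \<Rightarrow> 'a \<Rightarrow> 'a) \<Rightarrow> bool" where
  "cube_embeds n A m \<longleftrightarrow>
     (\<exists>f. median_preserving (cube n) (cube_median n) A m f \<and> inj_on f (cube n))"

(* In enat the supremum of the empty set is 0, which is the rank of the empty algebra. *)
definition median_rank :: "'a set \<Rightarrow> ('a \<Rightarrow> 'a \<Rightarrow> 'a \<Rightarrow> 'a) \<Rightarrow> enat" where
  "median_rank A m = Sup (enat ` {n. cube_embeds n A m})"

(* The sequence is f 1, ..., f k.  An empty intersection is all of A. *)
definition independent_seq :: "'a set \<Rightarrow> nat \<Rightarrow> (nat \<Rightarrow> 'a \<Rightarrow> real) \<Rightarrow> bool" where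
  "independent_seq A k f \<longleftrightarrow>
     (\<exists>a b. a < b \<and>
        (\<forall>P M. P \<subseteq> {1..k} \<and> M \<subseteq> {1..k} \<and> P \<inter> M = {} \<longrightarrow>
           A \<inter> (\<Inter>i\<in>P. f i -` {..a}) \<inter> (\<Inter>j\<in>M. f j -` {b..}) \<noteq> {}))"

definition ind :: "'a set \<Rightarrow> ('a \<Rightarrow> real) set \<Rightarrow> enat" where
  "ind A F = Sup (enat ` {k. \<exists>f. (\<forall>i\<in>{1..k}. f i \<in> F) \<and> independent_seq A k f})"

(* Maps are normalised to be undefined off the space, so that each map occurs once. *)
definition MC ::
    "'a topology \<Rightarrow> ('a \<Rightarrow> 'a \<Rightarrow> 'a \<Rightarrow> 'a) \<Rightarrow> 'b topology \<Rightarrow> ('b \<Rightarrow> 'b \<Rightarrow> 'b \<Rightarrow> 'b) \<Rightarrow> ('a \<Rightarrow> 'b) set" where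
  "MC X m Y m' = {f \<in> extensional (topspace X).
     continuous_map X Y f \<and> median_preserving (topspace X) m (topspace Y) m' f}"

abbreviation MC01 :: "'a topology \<Rightarrow> ('a \<Rightarrow> 'a \<Rightarrow> 'a \<Rightarrow> 'a) \<Rightarrow> ('a \<Rightarrow> real) set" where
  "MC01 X m \<equiv> MC X m (top_of_set {0..1}) middle"

end

(* Upper bound: an independent sequence f_1, ..., f_k maps X onto a k-cube of sectors.  By
   induction on k this map has a median section: given sections over the two faces f_k <= a and
   f_k >= b, project one onto the interval spanned by the other and back; the two projections
   then identify the images of the faces, so that they fit together to a k-cube.

   Lower bound: let n be the rank and take an embedded n-cube.  Each of its edges spans an interval
   that is a chain, since two incomparable points would give a square, and the product of this
   square with the complementary face would be an (n+1)-cube.  For an edge [p, e] choose a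
   Urysohn function h with h p = 0, h e = 1; its running maximum z |-> max_w h (m p w z) is
   continuous and monotone, hence median-preserving on the chain.  Composing it with the
   projections of X onto the n edges at a vertex gives n independent maps. *)
theory Submission
  imports Defs
begin

section \<open>Betweenness and projections onto intervals\<close>

context median_algebra
begin

definition between :: "'a \<Rightarrow> 'a \<Rightarrow> 'a \<Rightarrow> bool" where
  "between a c b \<longleftrightarrow> a \<in> A \<and> b \<in> A \<and> c \<in> A \<and> m a c b = c"

lemma swap13: "\<lbrakk>a \<in> A; b \<in> A; c \<in> A\<rbrakk> \<Longrightarrow> m a b c = m c b a"
  by (metis swap12 swap23)

lemma rot: "\<lbrakk>a \<in> A; b \<in> A; c \<in> A\<rbrakk> \<Longrightarrow> m a b c = m b c a"
  by (metis swap12 swap23)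

lemma between_mem: "between a c b \<Longrightarrow> a \<in> A \<and> b \<in> A \<and> c \<in> A"
  by (simp add: between_def)

lemma between_sym: "between a c b \<Longrightarrow> between b c a"
  unfolding between_def by (metis swap13)

lemma between_left: "\<lbrakk>a \<in> A; b \<in> A\<rbrakk> \<Longrightarrow> between a a b"
  unfolding between_def by (metis absorb swap12 swap23)

lemma between_median:
  assumes "a \<in> A" "b \<in> A" "c \<in> A"
  shows "between a (m a b c) b" "between b (m a b c) c" "between a (m a b c) c"
proof -
  have *: "between x (m x y z) y" if "x \<in> A" "y \<in> A" "z \<in> A" for x y z
  proof -
    have "m (m z x y) x y = m z x (m y x y)" using assoc that by metis
    also have "\<dots> = m z x y" using that by (metis absorb swap12 swap23)
    finally show ?thesis unfolding between_def using that by (metis closed rot swap23)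
  qed
  show "between a (m a b c) b" "between b (m a b c) c" "between a (m a b c) c"
    using *[of a b c] *[of b c a] *[of a c b] assms by (metis rot, metis rot, metis swap23)
qed

lemma between_trans:
  assumes "between a c b" "between a d c"
  shows "between a d b" "between d c b"
proof -
  have mem: "a \<in> A" "b \<in> A" "c \<in> A" "d \<in> A" using assms by (auto simp: between_def)
  have 1: "m b a c = c" and 2: "m c a d = d"
    using assms mem unfolding between_def by (metis rot swap12 swap23)+
  have "m b a d = m b a (m c a d)" using 2 by simp
  also have "\<dots> = m (m b a c) a d" using assoc[of b c d a] mem by simp
  finally have "m b a d = d" using 1 2 by simp
  then show "between a d b" unfolding between_def using mem by (metis rot swap23)
  have "m d c b = m (m d c a) c b"
    using 2 mem by (metis rot)
  also have "\<dots> = m d c (m a c b)" using assoc[of d a b c] mem by simp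
  also have "\<dots> = c" using 1 mem absorb by (metis rot)
  finally show "between d c b" unfolding between_def using mem by simp
qed

lemma between_antisym: "\<lbrakk>between a c b; between a b c\<rbrakk> \<Longrightarrow> b = c"
  unfolding between_def by (metis swap23)

lemma between_meet:
  assumes "between a w b" "between a w c"
  shows "between a w (m a b c)"
proof -
  have mem: "a \<in> A" "b \<in> A" "c \<in> A" "w \<in> A" using assms by (auto simp: between_def)
  have "m (m c a b) a w = m c a (m b a w)" using assoc mem by simp
  also have "m b a w = w" using assms(1) mem unfolding between_def by (metis rot)
  also have "m c a w = w" using assms(2) mem unfolding between_def by (metis rot)
  finally show ?thesis unfolding between_def using mem by (metis closed rot)
qed

lemma between_unique:
  assumes "between a w b" "between b w c" "between a w c"
  shows "m a b c = w"
proof -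
  have mem: "a \<in> A" "b \<in> A" "c \<in> A" "w \<in> A" using assms by (auto simp: between_def)
  define u where "u = m a b c"
  have 1: "between a w u" unfolding u_def using between_meet assms by blast
  have "between b w (m b a c)" using between_meet assms between_sym by blast
  then have 2: "between b w u" unfolding u_def using mem swap12 by simp
  have "between a u b" unfolding u_def using between_median mem by blast
  then have "between w u b" using between_trans(2) 1 by blast
  then show ?thesis using 2 between_antisym between_sym u_def by blast
qed

lemma relative_complement_unique:
  assumes "between d a e" "between d b e" "between a d c" "between a e c" "between b d c" "between b e c"
  shows "a = b"
proof -
  have mem: "a \<in> A" "b \<in> A" "c \<in> A" "d \<in> A" "e \<in> A" using assms by (auto simp: between_def)
  define f where "f = m c a b"
  have f: "between c f a" "between c f b" unfolding f_def
    using between_median mem by blast+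
  have df: "between c d f" "between c e f" unfolding f_def
    using between_meet between_sym assms by blast+
  have *: "f = x" if "between d x e" "between c f x" for x
  proof -
    have "between x f d" "between x f e"
      using between_trans(2)[OF that(2)] df between_sym by blast+
    then have "between x f (m x d e)" by (rule between_meet)
    moreover have "m x d e = x" using that(1) unfolding between_def by (metis swap12)
    ultimately have "between x f x" by simp
    then show ?thesis unfolding between_def by (metis swap13 rot absorb)
  qed
  then show ?thesis using assms f by metis
qed

text \<open>The interval \<open>[t, w]\<close> is a lattice with bottom \<open>t\<close>, top \<open>w\<close>, meet \<open>m a t b\<close> and join \<open>m a w b\<close>.
  Uniqueness of relative complements excludes pentagon and diamond, so it is distributive.  The proof
  obtains only the case \<open>s = s \<sqinter> (x \<squnion> y) = t\<close> that is needed.\<close>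
lemma disjoint_join:
  assumes I: "between t x w" "between t y w" "between t s w"
    and w: "between x w y" and t: "between s t x" "between s t y"
  shows "s = t"
proof -
  define I where "I = {a. between t a w}"
  define le where "le = (\<lambda>a b. between t a b)"
  define mt where "mt = (\<lambda>a b. m a t b)"
  define jn where "jn = (\<lambda>a b. m a w b)"
  have mem: "t \<in> A" "w \<in> A" "\<And>a. a \<in> I \<Longrightarrow> a \<in> A" using I unfolding I_def by (auto simp: between_def)
  have tI: "t \<in> I" and wI: "w \<in> I" and xI: "x \<in> I" and yI: "y \<in> I" and sI: "s \<in> I"
    using mem I between_left between_sym unfolding I_def by blast+
  have le_dual: "le a b \<longleftrightarrow> between w b a" if "a \<in> I" "b \<in> I" for a b
    using that between_trans(2) between_sym unfolding I_def le_def by blast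
  have le_trans: "le a c" if "le a b" "le b c" for a b c
    using that between_trans(1) unfolding le_def by blast
  have anti: "a = b" if "le a b" "le b a" for a b
    using that between_antisym unfolding le_def by blast
  have mtI: "mt a b \<in> I" and mt1: "le (mt a b) a" and mt2: "le (mt a b) b"
    if "a \<in> I" "b \<in> I" for a b
  proof -
    show 1: "le (mt a b) a" and "le (mt a b) b" unfolding le_def mt_def
      using between_median[of a t b] between_sym that mem by blast+
    show "mt a b \<in> I" using 1 that between_trans(1) unfolding I_def le_def by blast
  qed
  have mtg: "le c (mt a b)" if "le c a" "le c b" for a b c
  proof -
    have "between t c (m t a b)" using that between_meet unfolding le_def by blast
    then show ?thesis using that unfolding le_def mt_def
      by (metis between_mem swap12)
  qed
  have jnI: "jn a b \<in> I" and jn1: "le a (jn a b)" and jn2: "le b (jn a b)"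
    if "a \<in> I" "b \<in> I" for a b
  proof -
    have "between w (jn a b) a" "between w (jn a b) b" unfolding jn_def
      using between_median[of a w b] between_sym that mem by blast+
    moreover from this show "jn a b \<in> I" using that between_trans(1) between_sym unfolding I_def by blast
    ultimately show "le a (jn a b)" "le b (jn a b)" using that le_dual by blast+
  qed
  have jnl: "le (jn a b) c" if "le a c" "le b c" "a \<in> I" "b \<in> I" "c \<in> I" for a b c
  proof -
    have "between w c a" "between w c b" using that le_dual by blast+
    then have "between w c (m w a b)" using between_meet by blast
    moreover have "m w a b = jn a b" unfolding jn_def using that mem by (metis swap12)
    ultimately show ?thesis using le_dual jnI that by metis
  qed
  have canc: "a = b" if "mt a c = mt b c" "jn a c = jn b c" "a \<in> I" "b \<in> I" "c \<in> I" for a b c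
  proof (rule relative_complement_unique)
    have *: "between (mt a c) a (jn a c)" if "a \<in> I" "c \<in> I" for a c
      using mt1 jn1 that between_trans(2) unfolding le_def by blast
    show "between (mt a c) a (jn a c)" "between (mt a c) b (jn a c)"
      using * that by metis+
    show "between a (mt a c) c" "between a (jn a c) c" "between b (mt a c) c" "between b (jn a c) c"
      using between_median(3)[of _ t c] between_median(3)[of _ w c] that mem
      unfolding mt_def jn_def by metis+
  qed
  have le_refl: "le a a" if "a \<in> I" for a
    using that mem unfolding le_def by (simp add: between_def absorb)
  have lat: "le a c \<Longrightarrow> a \<in> I \<Longrightarrow> b \<in> I \<Longrightarrow> le (mt a b) c"
     "le b c \<Longrightarrow> a \<in> I \<Longrightarrow> b \<in> I \<Longrightarrow> le (mt a b) c"
     "le c a \<Longrightarrow> a \<in> I \<Longrightarrow> b \<in> I \<Longrightarrow> le c (jn a b)"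
     "le c b \<Longrightarrow> a \<in> I \<Longrightarrow> b \<in> I \<Longrightarrow> le c (jn a b)"
     "a \<in> I \<Longrightarrow> le a a" for a b c
    using mt1 mt2 jn1 jn2 le_trans le_refl by blast+
  have modular: "jn a (mt c b) = mt (jn a c) b" if "le a b" "a \<in> I" "b \<in> I" "c \<in> I" for a b c
  proof (rule canc)
    let ?l = "jn a (mt c b)" and ?r = "mt (jn a c) b"
    show lI: "?l \<in> I" and rI: "?r \<in> I" and "c \<in> I" using that mtI jnI by blast+
    have cb: "mt c b \<in> I" using that mtI by blast
    have ac: "jn a c \<in> I" using that jnI by blast
    have lr: "le ?l ?r"
      using that by (auto intro!: mtg jnl mtI jnI intro: lat)
    have 1: "le (mt ?r c) (mt c b)"
      using that rI ac by (auto intro!: mtg jnl mtI jnI intro: lat)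
    have 2: "le (mt ?r c) (mt ?l c)"
      using 1 that rI cb by (auto intro!: mtg jnl mtI jnI intro: lat)
    have 3: "le (mt ?l c) (mt ?r c)"
      using lr that lI by (auto intro!: mtg jnl mtI jnI intro: lat)
    show "mt ?l c = mt ?r c" using 2 3 anti by blast
    have lc: "jn ?l c \<in> I" and rc: "jn ?r c \<in> I" using jnI lI rI that by blast+
    have 4: "le (jn a c) (jn ?l c)"
      using that lI cb lc by (auto intro!: mtg jnl mtI jnI intro: lat)
    have 5: "le (jn ?r c) (jn ?l c)"
      using 4 that lI rI cb lc ac by (auto intro!: mtg jnl mtI jnI intro: lat)
    have 6: "le (jn ?l c) (jn ?r c)"
      using lr that lI rI rc by (auto intro!: mtg jnl mtI jnI intro: lat)
    show "jn ?l c = jn ?r c" using 5 6 anti by blast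
  qed
  have le_mt: "mt a b = a" "mt b a = a" if "le a b" "a \<in> I" "b \<in> I" for a b
  proof -
    have "le a a" using that mem unfolding le_def by (simp add: between_def absorb)
    then show "mt a b = a" "mt b a = a"
      using that mtg[of a a b] mtg[of a b a] mt1[of a b] mt2[of b a] anti by auto
  qed
  have le_jn: "jn a b = b" "jn b a = b" if "le a b" "a \<in> I" "b \<in> I" for a b
  proof -
    have "le b b" using that mem unfolding le_def by (simp add: between_def absorb)
    then show "jn a b = b" "jn b a = b"
      using that jnl[of a b b] jnl[of b b a] jn1[of b a] jn2[of a b] anti by auto
  qed
  have t_le: "le t a" and le_w: "le a w" if "a \<in> I" for a
    using that between_left mem unfolding le_def I_def by auto
  have jn_comm: "jn a b = jn b a" if "a \<in> I" "b \<in> I" for a b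
    unfolding jn_def using that mem swap13 by auto
  have xy: "jn x y = w" and sx: "mt s x = t" and sy: "mt s y = t"
    unfolding mt_def jn_def using w t unfolding between_def by auto
  define u where "u = jn x s"
  have uI: "u \<in> I" and xu: "le x u" and su: "le s u" using jnI jn1 jn2 xI sI u_def by auto
  define y' where "y' = mt y u"
  have y'I: "y' \<in> I" using y'_def mtI yI uI by blast
  have xy': "jn x y' = u"
    using modular[OF xu xI uI yI] unfolding y'_def xy using le_mt le_w uI wI by metis
  define z where "z = mt y' x"
  have zI: "z \<in> I" and zx: "le z x" using z_def mtI mt2 y'I xI by auto
  have "jn z (mt s x) = mt (jn z s) x" using modular zx zI xI sI by blast
  then have zs: "mt (jn z s) x = z" using sx le_jn t_le zI tI by metis
  have zsI: "jn z s \<in> I" using jnI zI sI by blast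
  have "jn z s = y'"
  proof (rule canc)
    show "mt (jn z s) x = mt y' x" using zs z_def by simp
    have "le u (jn (jn z s) x)" unfolding u_def
      using zsI zI sI xI by (auto intro!: mtg jnl mtI jnI intro: lat)
    moreover have "le (jn (jn z s) x) u"
      using zsI zI sI xI uI xu su le_trans[OF zx xu] by (auto intro!: mtg jnl mtI jnI intro: lat)
    ultimately show "jn (jn z s) x = jn y' x" using anti xy' jn_comm xI y'I by metis
  qed (use zsI y'I xI in auto)
  then have "le s y" using jn2[OF zI sI] mt1[OF yI uI] y'_def le_trans by metis
  then show ?thesis using sy le_mt sI yI by metis
qed

lemma between_slide:
  assumes c: "between a c b" and t: "between a t z" "between b t z"
  shows "between c t z"
proof -
  have mem: "a \<in> A" "b \<in> A" "c \<in> A" "t \<in> A" "z \<in> A" using assms by (auto simp: between_def)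
  define s where "s = m c t z"
  define x where "x = m a c t"
  define y where "y = m b c t"
  have s: "between c s t" "between t s z" "between c s z" unfolding s_def
    using between_median mem by blast+
  have x: "between a x c" "between c x t" "between a x t" unfolding x_def
    using between_median mem by blast+
  have y: "between b y c" "between c y t" "between b y t" unfolding y_def
    using between_median mem by blast+
  have "between x c y"
    using between_trans(2)[OF between_sym[OF between_trans(2)[OF c x(1)]] y(1)] by (rule between_sym)
  moreover have "between s t x"
    using between_trans(2)[OF between_sym[OF between_trans(2)[OF between_sym[OF t(1)] between_sym[OF s(2)]]] x(3)]
    by (rule between_sym)
  moreover have "between s t y"
    using between_trans(2)[OF between_sym[OF between_trans(2)[OF between_sym[OF t(2)] between_sym[OF s(2)]]] y(3)]
    by (rule between_sym)
  ultimately have "s = t"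
    using disjoint_join[OF between_sym[OF x(2)] between_sym[OF y(2)] between_sym[OF s(1)]] by blast
  then show ?thesis using s by simp
qed

lemma between_convex:
  assumes "between u v c" "between a u b" "between a c b"
  shows "between a v b"
proof -
  have mem: "a \<in> A" "b \<in> A" "c \<in> A" "u \<in> A" "v \<in> A" using assms by (auto simp: between_def)
  define t where "t = m a v b"
  have t: "between a t v" "between b t v" "between a t b" unfolding t_def
    using between_median[of a v b] between_sym mem by blast+
  have "between v t u" "between v t c"
    using between_slide[OF assms(2) t(1,2), THEN between_sym]
      between_slide[OF assms(3) t(1,2), THEN between_sym] by blast+
  then have "between v t (m v u c)" using between_meet by blast
  moreover have "m v u c = v" using assms(1) mem unfolding between_def by (metis swap12)
  ultimately have "m v t v = t" unfolding between_def by simp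
  then have "t = v" using mem swap12[of v t v] absorb[of t v] between_mem[OF t(1)] by simp
  then show ?thesis using t by simp
qed

definition proj :: "'a \<Rightarrow> 'a \<Rightarrow> 'a \<Rightarrow> 'a" where
  "proj p q x = m p x q"

lemma proj_between: "\<lbrakk>p \<in> A; q \<in> A; x \<in> A\<rbrakk> \<Longrightarrow> between p (proj p q x) q"
  unfolding proj_def by (rule between_median)

lemma proj_id: "between p x q \<Longrightarrow> proj p q x = x"
  unfolding proj_def between_def by blast

lemma proj_gate:
  assumes "between p r q" "x \<in> A"
  shows "between x (proj p q x) r"
proof -
  have mem: "p \<in> A" "q \<in> A" using assms(1) by (auto simp: between_def)
  have "between p (proj p q x) x" "between q (proj p q x) x"
    unfolding proj_def using between_median[of p x q] between_sym mem assms(2) by blast+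
  then show ?thesis by (intro between_sym[OF between_slide[OF assms(1)]])
qed

lemma proj_preserves_between:
  assumes pq: "p \<in> A" "q \<in> A" and c: "between a c b"
  shows "between (proj p q a) (proj p q c) (proj p q b)"
proof -
  have mem: "a \<in> A" "b \<in> A" "c \<in> A" using c by (auto simp: between_def)
  let ?a = "proj p q a" and ?b = "proj p q b" and ?c = "proj p q c"
  have I: "between p ?a q" "between p ?b q" "between p ?c q"
    using proj_between pq mem by auto
  then have mem': "?a \<in> A" "?b \<in> A" "?c \<in> A" by (auto simp: between_def)
  define k where "k = m ?a ?c ?b"
  have k: "between ?a k ?c" "between ?b k ?c" "between ?a k ?b" unfolding k_def
    using between_median between_sym mem' by blast+
  have "between p k q" using between_convex[OF k(1)] I by blast
  then have 1: "between c ?c k" using proj_gate mem by blast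
  have "between a ?a ?c" "between b ?b ?c" using proj_gate I mem by blast+
  then have "between ?c k a" "between ?c k b"
    using between_trans(1)[OF _ k(1)[THEN between_sym]] between_trans(1)[OF _ k(2)[THEN between_sym]]
    by (blast dest: between_sym)+
  then have "between c k ?c" using between_slide[OF c] between_sym by blast
  then have "k = ?c" using 1 between_antisym by blast
  then show ?thesis using k by simp
qed

lemma proj_median:
  assumes "p \<in> A" "q \<in> A" "x \<in> A" "y \<in> A" "z \<in> A"
  shows "proj p q (m x y z) = m (proj p q x) (proj p q y) (proj p q z)"
  by (rule sym, rule between_unique; rule proj_preserves_between)
    (use assms between_median in auto)

end

section \<open>Cubes from independent functions\<close>

lemma middle_le:
  fixes a :: "'a::linorder"
  shows "x \<le> a \<Longrightarrow> y \<le> a \<Longrightarrow> middle x y z \<le> a" "x \<le> a \<Longrightarrow> z \<le> a \<Longrightarrow> middle x y z \<le> a"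
    "y \<le> a \<Longrightarrow> z \<le> a \<Longrightarrow> middle x y z \<le> a"
  by (auto simp: middle_def min_le_iff_disj)

lemma le_middle:
  fixes a :: "'a::linorder"
  shows "a \<le> x \<Longrightarrow> a \<le> y \<Longrightarrow> a \<le> middle x y z" "a \<le> x \<Longrightarrow> a \<le> z \<Longrightarrow> a \<le> middle x y z"
    "a \<le> y \<Longrightarrow> a \<le> z \<Longrightarrow> a \<le> middle x y z"
  by (auto simp: middle_def le_max_iff_disj)

lemma cube_val: "\<lbrakk>s \<in> cube n; i < n\<rbrakk> \<Longrightarrow> s i = 0 \<or> s i = 1"
  by (auto simp: cube_def PiE_def Pi_def)

lemma cube_eqI: "\<lbrakk>s \<in> cube n; t \<in> cube n; \<And>i. i < n \<Longrightarrow> s i = t i\<rbrakk> \<Longrightarrow> s = t"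
  unfolding cube_def by (metis PiE_ext lessThan_iff)

lemma restrict_in_cube:
  "(\<And>i. i < n \<Longrightarrow> s i = 0 \<or> s i = 1) \<Longrightarrow> restrict s {..<n} \<in> cube n"
  by (auto simp: cube_def)

lemma middle_01:
  fixes a :: nat
  shows "a = 0 \<or> a = 1 \<Longrightarrow> b = 0 \<or> b = 1 \<Longrightarrow> c = 0 \<or> c = 1 \<Longrightarrow> middle a b c = 0 \<or> middle a b c = 1"
  by (auto simp: middle_def)

lemma cube_median_nth [simp]: "i < n \<Longrightarrow> cube_median n x y z i = middle (x i) (y i) (z i)"
  by (simp add: cube_median_def)

lemma cube_median_closed:
  "\<lbrakk>x \<in> cube n; y \<in> cube n; z \<in> cube n\<rbrakk> \<Longrightarrow> cube_median n x y z \<in> cube n"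
  unfolding cube_median_def by (rule restrict_in_cube) (metis middle_01 cube_val)

lemma restrict_cube_median:
  "k \<le> n \<Longrightarrow> restrict (cube_median n x y z) {..<k}
     = cube_median k (restrict x {..<k}) (restrict y {..<k}) (restrict z {..<k})"
  by (auto simp: cube_median_def fun_eq_iff)

context median_algebra
begin

lemma between_same: "between a c a \<Longrightarrow> c = a"
  unfolding between_def using swap12[of a c a] absorb by auto

lemma proj_closed: "\<lbrakk>p \<in> A; q \<in> A; x \<in> A\<rbrakk> \<Longrightarrow> proj p q x \<in> A"
  by (simp add: proj_def closed)

lemma median_preserving_between:
  assumes "median_preserving (cube n) (cube_median n) A m g"
    and "s \<in> cube n" "t \<in> cube n" "r \<in> cube n"
    and "\<And>i. i < n \<Longrightarrow> middle (s i) (t i) (r i) = t i"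
  shows "between (g s) (g t) (g r)"
proof -
  have "cube_median n s t r = t"
    by (rule cube_eqI) (use assms cube_median_closed in auto)
  then show ?thesis using assms unfolding median_preserving_def between_def by (metis Pi_mem)
qed

lemma subalgebra:
  assumes "B \<subseteq> A" "\<And>x y z. \<lbrakk>x \<in> B; y \<in> B; z \<in> B\<rbrakk> \<Longrightarrow> m x y z \<in> B"
  shows "median_algebra B m"
proof
  note B = subsetD[OF assms(1)]
  show "m a b c \<in> B" if "a \<in> B" "b \<in> B" "c \<in> B" for a b c by (rule assms(2)[OF that])
  show "m a b c = m b a c" if "a \<in> B" "b \<in> B" "c \<in> B" for a b c by (rule swap12[OF that[THEN B]])
  show "m a b c = m a c b" if "a \<in> B" "b \<in> B" "c \<in> B" for a b c by (rule swap23[OF that[THEN B]])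
  show "m a b b = b" if "a \<in> B" "b \<in> B" for a b by (rule absorb[OF that[THEN B]])
  show "m (m a x b) x c = m a x (m b x c)" if "a \<in> B" "b \<in> B" "c \<in> B" "x \<in> B" for a b c x
    by (rule assoc[OF that[THEN B]])
qed

end

lemma cube_section:
  fixes F :: "nat \<Rightarrow> 'a \<Rightarrow> real"
  assumes "median_algebra A m" "a < b"
    and "\<And>i x y z. \<lbrakk>i < k; x \<in> A; y \<in> A; z \<in> A\<rbrakk> \<Longrightarrow> F i (m x y z) = middle (F i x) (F i y) (F i z)"
    and "\<And>P. P \<subseteq> {..<k} \<Longrightarrow> \<exists>x\<in>A. \<forall>i<k. (i \<in> P \<longrightarrow> b \<le> F i x) \<and> (i \<notin> P \<longrightarrow> F i x \<le> a)"
  shows "\<exists>g. median_preserving (cube k) (cube_median k) A m g \<and>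
     (\<forall>s\<in>cube k. \<forall>i<k. (s i = 1 \<longrightarrow> b \<le> F i (g s)) \<and> (s i = 0 \<longrightarrow> F i (g s) \<le> a))"
  using assms
proof (induction k arbitrary: A)
  case 0
  then interpret median_algebra A m by simp
  obtain x where "x \<in> A" using "0.prems"(4)[of "{}"] by auto
  then have "median_preserving (cube 0) (cube_median 0) A m (\<lambda>_. x)"
    by (simp add: median_preserving_def absorb)
  then show ?case by auto
next
  case (Suc k)
  interpret median_algebra A m by (rule Suc.prems)
  note Fm = Suc.prems(3)
  define A0 where "A0 = {x \<in> A. F k x \<le> a}"
  define A1 where "A1 = {x \<in> A. b \<le> F k x}"
  have alg: "median_algebra A0 m" "median_algebra A1 m"
    by (rule subalgebra; auto simp: A0_def A1_def closed Fm middle_le le_middle)+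
  have "\<exists>x\<in>A0. \<forall>i<k. (i \<in> P \<longrightarrow> b \<le> F i x) \<and> (i \<notin> P \<longrightarrow> F i x \<le> a)" if P: "P \<subseteq> {..<k}" for P
  proof -
    have "P \<subseteq> {..<Suc k}" "k \<notin> P" using P by auto
    then obtain x where x: "x \<in> A" "\<forall>i<Suc k. (i \<in> P \<longrightarrow> b \<le> F i x) \<and> (i \<notin> P \<longrightarrow> F i x \<le> a)"
      using Suc.prems(4)[of P] by blast
    then show ?thesis using \<open>k \<notin> P\<close> unfolding A0_def by (intro bexI[of _ x]) auto
  qed
  note sect0 = this
  have Fm0: "F i (m x y z) = middle (F i x) (F i y) (F i z)"
    if "i < k" "x \<in> A0" "y \<in> A0" "z \<in> A0" for i x y z
    using Fm[of i x y z] that unfolding A0_def by simp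
  obtain g0 where g0: "median_preserving (cube k) (cube_median k) A0 m g0"
    and g0F: "\<And>s i. \<lbrakk>s \<in> cube k; i < k\<rbrakk> \<Longrightarrow> (s i = 1 \<longrightarrow> b \<le> F i (g0 s)) \<and> (s i = 0 \<longrightarrow> F i (g0 s) \<le> a)"
    using Suc.IH[OF alg(1) \<open>a < b\<close> Fm0 sect0] by blast
  have "\<exists>x\<in>A1. \<forall>i<k. (i \<in> P \<longrightarrow> b \<le> F i x) \<and> (i \<notin> P \<longrightarrow> F i x \<le> a)" if P: "P \<subseteq> {..<k}" for P
  proof -
    have "insert k P \<subseteq> {..<Suc k}" using P by auto
    then obtain x where x: "x \<in> A" "\<forall>i<Suc k. (i \<in> insert k P \<longrightarrow> b \<le> F i x) \<and> (i \<notin> insert k P \<longrightarrow> F i x \<le> a)"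
      using Suc.prems(4)[of "insert k P"] by blast
    then show ?thesis unfolding A1_def by (intro bexI[of _ x]) auto
  qed
  note sect1 = this
  have Fm1: "F i (m x y z) = middle (F i x) (F i y) (F i z)"
    if "i < k" "x \<in> A1" "y \<in> A1" "z \<in> A1" for i x y z
    using Fm[of i x y z] that unfolding A1_def by simp
  obtain g1 where g1: "median_preserving (cube k) (cube_median k) A1 m g1"
    and g1F: "\<And>s i. \<lbrakk>s \<in> cube k; i < k\<rbrakk> \<Longrightarrow> (s i = 1 \<longrightarrow> b \<le> F i (g1 s)) \<and> (s i = 0 \<longrightarrow> F i (g1 s) \<le> a)"
    using Suc.IH[OF alg(2) \<open>a < b\<close> Fm1 sect1] by blast
  define bt where "bt = restrict (\<lambda>_. 0::nat) {..<k}"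
  define tp where "tp = restrict (\<lambda>_. 1::nat) {..<k}"
  have bt: "bt \<in> cube k" and tp: "tp \<in> cube k" unfolding bt_def tp_def by (auto intro: restrict_in_cube)
  have g0A0: "g0 s \<in> A0" and g1A1: "g1 s \<in> A1" if "s \<in> cube k" for s
    using g0 g1 that unfolding median_preserving_def by auto
  then have g0A: "g0 s \<in> A" and g1A: "g1 s \<in> A" if "s \<in> cube k" for s
    using that A0_def A1_def by auto
  have g0': "median_preserving (cube k) (cube_median k) A m g0"
    using g0 unfolding median_preserving_def A0_def by auto
  define p0 where "p0 = g0 bt"
  define q0 where "q0 = g0 tp"
  define p1 where "p1 = g1 bt"
  define q1 where "q1 = g1 tp"
  have mem: "p0 \<in> A" "q0 \<in> A" "p1 \<in> A" "q1 \<in> A"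
    unfolding p0_def q0_def p1_def q1_def using g0A g1A bt tp by auto
  have Fp: "F i p0 \<le> a" "F i p1 \<le> a" "b \<le> F i q0" "b \<le> F i q1" if "i < k" for i
    using g0F[OF bt that] g1F[OF bt that] g0F[OF tp that] g1F[OF tp that] that
    by (auto simp: bt_def tp_def p0_def p1_def q0_def q1_def)
  have Fk: "F k p0 \<le> a" "F k q0 \<le> a" "b \<le> F k p1" "b \<le> F k q1"
    using g0A0 g1A1 bt tp unfolding A0_def A1_def p0_def p1_def q0_def q1_def by auto
  have g0I: "between p0 (g0 s) q0" if "s \<in> cube k" for s
    unfolding p0_def q0_def
    by (rule median_preserving_between[OF g0' bt that tp])
      (use cube_val[OF that] in \<open>fastforce simp: bt_def tp_def middle_def\<close>)
  define u where "u = (\<lambda>s. proj p1 q1 (g0 s))"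
  define v where "v = (\<lambda>s. proj p0 q0 (u s))"
  have uI: "between p1 (u s) q1" if "s \<in> cube k" for s
    unfolding u_def using proj_between mem g0A that by simp
  then have uA: "u s \<in> A" if "s \<in> cube k" for s using that between_mem by blast
  have vI: "between p0 (v s) q0" if "s \<in> cube k" for s
    unfolding v_def using proj_between mem uA that by simp
  then have vA: "v s \<in> A" if "s \<in> cube k" for s using that between_mem by blast
  have pv: "proj p1 q1 (v s) = u s" if "s \<in> cube k" for s
  proof -
    have "between (u s) (v s) (g0 s)" unfolding v_def
      using proj_gate g0I uA that by simp
    then have "between (proj p1 q1 (u s)) (proj p1 q1 (v s)) (proj p1 q1 (g0 s))"
      using proj_preserves_between mem by blast
    then have "between (u s) (proj p1 q1 (v s)) (u s)"
      using proj_id[OF uI[OF that]] unfolding u_def by simp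
    then show ?thesis using between_same by blast
  qed
  have u_hom: "u (cube_median k s t r) = m (u s) (u t) (u r)"
    if "s \<in> cube k" "t \<in> cube k" "r \<in> cube k" for s t r
    using g0 that g0A mem proj_median unfolding u_def median_preserving_def by simp
  have v_hom: "v (cube_median k s t r) = m (v s) (v t) (v r)"
    if "s \<in> cube k" "t \<in> cube k" "r \<in> cube k" for s t r
    using that uA mem proj_median u_hom unfolding v_def by simp
  let ?r = "\<lambda>s. restrict s {..<k}"
  define g where "g = (\<lambda>s. if s k = (0::nat) then v (?r s) else u (?r s))"
  have rc: "?r s \<in> cube k" if "s \<in> cube (Suc k)" for s
    by (rule restrict_in_cube) (metis cube_val that less_SucI)
  have gA: "g s \<in> A" if "s \<in> cube (Suc k)" for s
    using uA vA rc that g_def by auto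
  have pg0: "proj p0 q0 (g s) = v (?r s)" if "s \<in> cube (Suc k)" for s
    using proj_id[OF vI[OF rc[OF that]]] unfolding g_def by (auto simp: v_def)
  have pg1: "proj p1 q1 (g s) = u (?r s)" if "s \<in> cube (Suc k)" for s
    using proj_id[OF uI[OF rc[OF that]]] pv[OF rc[OF that]] unfolding g_def by auto
  have hom: "g (cube_median (Suc k) s t r) = m (g s) (g t) (g r)"
    if s: "s \<in> cube (Suc k)" and t: "t \<in> cube (Suc k)" and r: "r \<in> cube (Suc k)" for s t r
  proof -
    let ?w = "m (g s) (g t) (g r)"
    have b: "between (g s) ?w (g t)" "between (g t) ?w (g r)" "between (g s) ?w (g r)"
      using between_median gA s t r by auto
    have v: "s k = 0 \<or> s k = 1" "t k = 0 \<or> t k = 1" "r k = 0 \<or> r k = 1"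
      using cube_val s t r by blast+
    have cr: "?r (cube_median (Suc k) s t r) = cube_median k (?r s) (?r t) (?r r)"
      by (simp add: restrict_cube_median)
    have ck: "cube_median (Suc k) s t r k = middle (s k) (t k) (r k)" by simp
    show ?thesis
    proof (cases "middle (s k) (t k) (r k) = 0")
      case True
      then have two: "s k = 0 \<and> t k = 0 \<or> t k = 0 \<and> r k = 0 \<or> s k = 0 \<and> r k = 0"
        using v by (auto simp: middle_def)
      have "between p0 (g x) q0" if "x \<in> cube (Suc k)" "x k = 0" for x
        using vI rc that unfolding g_def by simp
      then have "between p0 ?w q0" using two b between_convex s t r by metis
      then have "?w = proj p0 q0 ?w" using proj_id by simp
      also have "\<dots> = v (cube_median k (?r s) (?r t) (?r r))"
        using proj_median mem gA s t r pg0 v_hom rc by simp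
      finally show ?thesis using True cr ck unfolding g_def by simp
    next
      case False
      then have two: "s k = 1 \<and> t k = 1 \<or> t k = 1 \<and> r k = 1 \<or> s k = 1 \<and> r k = 1"
        using v by (auto simp: middle_def)
      have "between p1 (g x) q1" if "x \<in> cube (Suc k)" "x k = 1" for x
        using uI rc that unfolding g_def by simp
      then have "between p1 ?w q1" using two b between_convex s t r by metis
      then have "?w = proj p1 q1 ?w" using proj_id by simp
      also have "\<dots> = u (cube_median k (?r s) (?r t) (?r r))"
        using proj_median mem gA s t r pg1 u_hom rc by simp
      finally show ?thesis using False cr ck unfolding g_def by simp
    qed
  qed
  have Fpr: "F i (proj p q x) = middle (F i p) (F i x) (F i q)"
    if "i < Suc k" "p \<in> A" "q \<in> A" "x \<in> A" for i p q x
    unfolding proj_def using Fm that by simp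
  have Fu: "(s i = 1 \<longrightarrow> b \<le> F i (u s)) \<and> (s i = 0 \<longrightarrow> F i (u s) \<le> a)" if "s \<in> cube k" "i < k" for s i
    using g0F[OF that] Fp[OF that(2)] Fpr[of i p1 q1 "g0 s"] mem g0A that
    unfolding u_def by (auto simp: middle_le le_middle)
  have Fv: "(s i = 1 \<longrightarrow> b \<le> F i (v s)) \<and> (s i = 0 \<longrightarrow> F i (v s) \<le> a)" if "s \<in> cube k" "i < k" for s i
    using Fu[OF that] Fp[OF that(2)] Fpr[of i p0 q0 "u s"] mem uA that
    unfolding v_def by (auto simp: middle_le le_middle)
  have Fku: "b \<le> F k (u s)" if "s \<in> cube k" for s
    using Fk(3,4) Fpr[of k p1 q1 "g0 s"] mem g0A[OF that] unfolding u_def by (simp add: le_middle)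
  have Fkv: "F k (v s) \<le> a" if "s \<in> cube k" for s
    using Fk(1,2) Fpr[of k p0 q0 "u s"] mem uA[OF that] unfolding v_def by (simp add: middle_le)
  have "(s i = 1 \<longrightarrow> b \<le> F i (g s)) \<and> (s i = 0 \<longrightarrow> F i (g s) \<le> a)" if s: "s \<in> cube (Suc k)" and i: "i < Suc k" for s i
  proof (cases "i = k")
    case True
    then show ?thesis using Fku[OF rc[OF s]] Fkv[OF rc[OF s]] unfolding g_def by simp
  next
    case False
    then have "i < k" using i by simp
    then show ?thesis using Fu[OF rc[OF s], of i] Fv[OF rc[OF s], of i] unfolding g_def by simp
  qed
  moreover have "median_preserving (cube (Suc k)) (cube_median (Suc k)) A m g"
    using hom gA unfolding median_preserving_def by blast
  ultimately show ?case by blast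
qed

lemma cube_embeds_if_independent:
  fixes f :: "nat \<Rightarrow> 'a \<Rightarrow> real"
  assumes "median_algebra A m"
    and f: "\<And>i. i \<in> {1..k} \<Longrightarrow> median_preserving A m B middle (f i)"
    and "independent_seq A k f"
  shows "cube_embeds k A m"
proof -
  obtain a b where ab: "a < b" and ind: "\<forall>P M. P \<subseteq> {1..k} \<and> M \<subseteq> {1..k} \<and> P \<inter> M = {} \<longrightarrow>
           A \<inter> (\<Inter>i\<in>P. f i -` {..a}) \<inter> (\<Inter>j\<in>M. f j -` {b..}) \<noteq> {}"
    using assms(3) unfolding independent_seq_def by (elim exE conjE)
  define F where "F = (\<lambda>i. f (Suc i))"
  have sector: "\<exists>x\<in>A. \<forall>i<k. (i \<in> P \<longrightarrow> b \<le> F i x) \<and> (i \<notin> P \<longrightarrow> F i x \<le> a)" if "P \<subseteq> {..<k}" for P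
  proof -
    have "A \<inter> (\<Inter>i\<in>Suc ` ({..<k} - P). f i -` {..a}) \<inter> (\<Inter>j\<in>Suc ` P. f j -` {b..}) \<noteq> {}"
      by (rule ind[rule_format]) (use that in auto)
    then obtain x where x: "x \<in> A" "\<And>i. i \<in> {..<k} - P \<Longrightarrow> f (Suc i) x \<le> a" "\<And>i. i \<in> P \<Longrightarrow> b \<le> f (Suc i) x"
      by auto
    then show ?thesis unfolding F_def by (intro bexI[of _ x]) auto
  qed
  have Fm: "F i (m x y z) = middle (F i x) (F i y) (F i z)" if "i < k" "x \<in> A" "y \<in> A" "z \<in> A" for i x y z
  proof -
    have "Suc i \<in> {1..k}" using that by simp
    then show ?thesis using f that unfolding F_def median_preserving_def by blast
  qed
  obtain g where g: "median_preserving (cube k) (cube_median k) A m g"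
     and gF: "\<And>s i. \<lbrakk>s \<in> cube k; i < k\<rbrakk> \<Longrightarrow> (s i = 1 \<longrightarrow> b \<le> F i (g s)) \<and> (s i = 0 \<longrightarrow> F i (g s) \<le> a)"
    using cube_section[OF assms(1) ab Fm sector] by blast
  have "inj_on g (cube k)"
  proof (rule inj_onI)
    fix s t assume st: "s \<in> cube k" "t \<in> cube k" "g s = g t"
    show "s = t"
    proof (rule cube_eqI[OF st(1,2)])
      fix i assume i: "i < k"
      then show "s i = t i"
        using gF[OF st(1) i] gF[OF st(2) i] cube_val[OF st(1) i] cube_val[OF st(2) i] st(3) ab by auto
    qed
  qed
  then show ?thesis using g unfolding cube_embeds_def by blast
qed

section \<open>Edges of a maximal cube\<close>

context median_algebra
begin

text \<open>A square \<open>p, e, q, e'\<close> makes \<open>[p, q]\<close> the product of the intervals \<open>[p, e]\<close> and \<open>[p, e']\<close>;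
  pairing is the join \<open>m q u c\<close>.\<close>
lemma square_join:
  assumes sq: "between e p e'" "between e q e'" "between p e q" "between p e' q"
    and u: "between p u e" and c: "between p c e'"
  shows "proj p e (m q u c) = u"
proof -
  have mem: "e \<in> A" "p \<in> A" "e' \<in> A" "q \<in> A" "u \<in> A" "c \<in> A"
    using between_mem[OF sq(1)] between_mem[OF sq(2)] between_mem[OF u] between_mem[OF c] by auto
  have q: "proj p e q = e"
    using sq(3) swap23[of p q e] mem unfolding proj_def between_def by simp
  have p: "proj p e p = p"
    using proj_id between_left mem by simp
  have e': "proj p e e' = p"
    using sq(1) rot[of e p e'] mem unfolding proj_def between_def by simp
  have "between p (proj p e c) p"
    using proj_preserves_between[OF mem(2,1) c] p e' by simp
  then have "proj p e c = p" by (rule between_same)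
  moreover have "proj p e (m q u c) = m (proj p e q) (proj p e u) (proj p e c)"
    using proj_median mem by simp
  moreover have "m e u p = u"
    using u swap13[of e u p] mem unfolding between_def by simp
  ultimately show ?thesis using q proj_id[OF u] by simp
qed

lemma square_split:
  assumes sq: "between e p e'" "between e q e'" "between p e q" "between p e' q"
    and x: "between p x q"
  shows "m q (proj p e x) (proj p e' x) = x"
proof (rule between_unique)
  have mem: "e \<in> A" "p \<in> A" "e' \<in> A" "q \<in> A" "x \<in> A"
    using between_mem[OF sq(1)] between_mem[OF sq(2)] between_mem[OF x] by auto
  show "between q x (proj p e x)" "between q x (proj p e' x)"
    using between_trans(2)[OF x between_median(1), of e, THEN between_sym]
      between_trans(2)[OF x between_median(1), of e', THEN between_sym] mem
      swap23[of p x e] swap23[of p x e']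
    unfolding proj_def by simp_all
  have "proj p x q = x" using x swap23[of p x q] mem unfolding proj_def between_def by simp
  then have "between (proj p x e) x (proj p x e')"
    using proj_preserves_between[OF mem(2,5) sq(2)] by simp
  then show "between (proj p e x) x (proj p e' x)"
    using swap23[of p x e] swap23[of p x e'] mem unfolding proj_def by simp
qed

lemma square_join_between:
  assumes sq: "between p e q" "between p e' q" and u: "between p u e" and c: "between p c e'"
  shows "between p (m q u c) q"
proof (rule between_convex)
  show "between p u q" "between p c q" using between_trans(1)[OF sq(1) u] between_trans(1)[OF sq(2) c] by auto
  show "between u (m q u c) c"
    using between_median(2)[of q u c] between_mem[OF sq(1)] between_mem[OF u] between_mem[OF c] by simp
qed

lemma square_join_median:
  fixes u c :: "nat \<Rightarrow> 'a"
  assumes sq: "between e p e'" "between e q e'" "between p e q" "between p e' q"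
    and u: "\<And>i. i < 3 \<Longrightarrow> between p (u i) e" and c: "\<And>i. i < 3 \<Longrightarrow> between p (c i) e'"
  shows "m (m q (u 0) (c 0)) (m q (u 1) (c 1)) (m q (u 2) (c 2))
    = m q (m (u 0) (u 1) (u 2)) (m (c 0) (c 1) (c 2))"
proof -
  have sq': "between e' p e" "between e' q e" using sq(1,2)[THEN between_sym] by auto
  have mem: "e \<in> A" "p \<in> A" "e' \<in> A" "q \<in> A"
    using between_mem[OF sq(1)] between_mem[OF sq(2)] by auto
  define x where "x = (\<lambda>i. m q (u i) (c i))"
  have xI: "between p (x i) q" if "i < 3" for i
    unfolding x_def using square_join_between[OF sq(3,4) u c] that by simp
  have xA: "x i \<in> A" if "i < 3" for i using between_mem[OF xI[OF that]] by simp
  have uA: "u i \<in> A" and cA: "c i \<in> A" if "i < 3" for i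
    using between_mem[OF u[OF that]] between_mem[OF c[OF that]] by auto
  have px: "proj p e (x i) = u i" if "i < 3" for i
    unfolding x_def using square_join[OF sq u c] that by simp
  have px': "proj p e' (x i) = c i" if "i < 3" for i
    unfolding x_def using square_join[OF sq' sq(4,3) c[OF that] u[OF that]]
      swap23[of q "c i" "u i"] mem uA[OF that] cA[OF that] by simp
  let ?w = "m (x 0) (x 1) (x 2)"
  have "between (x 0) ?w (x 1)" using between_median(1)[of "x 0" "x 1" "x 2"] xA by simp
  then have "between p ?w q" by (rule between_convex) (use xI in simp_all)
  then have "?w = m q (proj p e ?w) (proj p e' ?w)" by (rule square_split[OF sq, symmetric])
  also have "proj p e ?w = m (u 0) (u 1) (u 2)" by (subst proj_median) (use mem xA px in simp_all)
  also have "proj p e' ?w = m (c 0) (c 1) (c 2)" by (subst proj_median) (use mem xA px' in simp_all)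
  finally show ?thesis unfolding x_def .
qed

lemma two_point_median:
  fixes a b c :: nat
  assumes "x \<in> A" "y \<in> A" "a = 0 \<or> a = 1" "b = 0 \<or> b = 1" "c = 0 \<or> c = 1"
  shows "(if middle a b c = 0 then x else y)
    = m (if a = 0 then x else y) (if b = 0 then x else y) (if c = 0 then x else y)"
proof -
  have "m x y y = y" "m y x x = x" "m x x x = x" "m y y y = y" using assms(1,2) absorb by auto
  moreover have "m x y x = m y x x" "m x x y = m x y x" "m y x y = m x y y" "m y y x = m y x y"
    by (rule swap12 swap23; use assms(1,2) in simp)+
  ultimately show ?thesis using assms(3-5) by (elim disjE) (simp_all add: middle_def)
qed


lemma cube_edge_chain:
  assumes g: "median_preserving (cube n) (cube_median n) A m g" and inj: "inj_on g (cube n)"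
    and not: "\<not> cube_embeds (Suc n) A m"
    and i: "i < n"
    and p_def: "p = g (restrict (\<lambda>_. 0) {..<n})"
    and e_def: "e = g (restrict (\<lambda>j. if j = i then 1 else 0) {..<n})"
    and z: "between p z e" and w: "between p w e"
  shows "between p z w \<or> between p w z"
proof (rule ccontr)
  assume incomp: "\<not> ?thesis"
  let ?r = "\<lambda>s. restrict s {..<n}"
  let ?bot = "?r (\<lambda>_. 0::nat)" and ?top = "?r (\<lambda>_. 1::nat)"
  let ?e = "?r (\<lambda>j. if j = i then 1 else 0::nat)" and ?e' = "?r (\<lambda>j. if j = i then 0 else 1::nat)"
  define q where "q = g ?top"
  define e' where "e' = g ?e'"
  have cubes: "?bot \<in> cube n" "?top \<in> cube n" "?e \<in> cube n" "?e' \<in> cube n"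
    by (rule restrict_in_cube; simp)+
  note bet = median_preserving_between[OF g]
  have sq: "between e p e'" "between e q e'" "between p e q" "between p e' q"
    unfolding p_def q_def e_def e'_def
    by (rule bet[OF cubes(3,1,4)] bet[OF cubes(3,2,4)] bet[OF cubes(1,3,2)] bet[OF cubes(1,4,2)];
        simp add: middle_def)+
  have mem: "e \<in> A" "p \<in> A" "e' \<in> A" "q \<in> A" "z \<in> A" "w \<in> A"
    using between_mem[OF sq(1)] between_mem[OF sq(2)] between_mem[OF z] between_mem[OF w] by auto
  define p' where "p' = proj z w p"
  define q' where "q' = proj z w e"
  have sq': "between z p' w" "between z q' w"
    unfolding p'_def q'_def using proj_between[OF mem(5,6)] mem(1,2) by simp_all
  have "proj z w z = z" "proj z w w = w"
    using proj_id[OF between_left[OF mem(5,6)]] proj_id[OF between_sym[OF between_left[OF mem(6,5)]]] .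
  then have sq'': "between p' z q'" "between p' w q'"
    unfolding p'_def q'_def
    using proj_preserves_between[OF mem(5,6) z] proj_preserves_between[OF mem(5,6) w] by simp_all
  have mem': "p' \<in> A" "q' \<in> A" using between_mem[OF sq'(1)] between_mem[OF sq'(2)] by auto
  have p'z: "p' \<noteq> z" and p'w: "p' \<noteq> w"
    using incomp swap12[of p z w] swap23[of p w z] mem unfolding p'_def proj_def between_def by simp_all
  have conv: "between p (m a b c) e" if "between p a e" "between p b e" "c \<in> A" for a b c
    by (rule between_convex[OF between_median(1)]) (use that between_mem in simp_all)
  have p'I: "between p p' e"
    using conv[OF z w mem(2)] mem swap23[of z w p] unfolding p'_def proj_def by simp
  define x where "x = (\<lambda>a::nat. if a = 0 then p' else z)"
  define y where "y = (\<lambda>a::nat. if a = 0 then p' else w)"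
  define d where "d = (\<lambda>a b. m q' (x a) (y b))"
  have xI: "between p' (x a) z" and yI: "between p' (y a) w" for a
    unfolding x_def y_def using between_left[OF mem'(1)] between_sym[OF between_left[OF _ mem'(1)]] mem by simp_all
  have xA: "x a \<in> A" and yA: "y a \<in> A" for a
    using between_mem[OF xI] between_mem[OF yI] by auto
  have dI: "between p (d a b) e" for a b
  proof -
    have "between p (x a) e" "between p (y b) e" unfolding x_def y_def using p'I z w by auto
    then have "between p (m (x a) (y b) q') e" by (rule conv[OF _ _ mem'(2)])
    then show ?thesis unfolding d_def using rot[of q' "x a" "y b"] mem'(2) xA yA by simp
  qed
  let ?c = "\<lambda>s. ?r (\<lambda>j. if j = i then 0 else s j)"
  define c where "c = (\<lambda>s. g (?c s))"
  define h where "h = (\<lambda>s. m q (d (s i) (s n)) (c s))"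
  have cc: "?c s \<in> cube n" if "s \<in> cube (Suc n)" for s
    by (rule restrict_in_cube) (use cube_val[OF that] in auto)
  have cI: "between p (c s) e'" if "s \<in> cube (Suc n)" for s
    unfolding p_def c_def e'_def
    by (rule bet[OF cubes(1) cc[OF that] cubes(4)])
      (use cube_val[OF that, OF less_SucI] in \<open>fastforce simp: middle_def\<close>)
  have hA: "h s \<in> A" if "s \<in> cube (Suc n)" for s
    using closed mem between_mem[OF dI] between_mem[OF cI[OF that]] unfolding h_def by simp
  have d_hom: "d (middle a1 a2 a3) (middle b1 b2 b3) = m (d a1 b1) (d a2 b2) (d a3 b3)"
    if a: "a1 = 0 \<or> a1 = 1" "a2 = 0 \<or> a2 = 1" "a3 = 0 \<or> a3 = 1"
      and b: "b1 = 0 \<or> b1 = 1" "b2 = 0 \<or> b2 = 1" "b3 = 0 \<or> b3 = 1" for a1 a2 a3 b1 b2 b3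
  proof -
    have "x (middle a1 a2 a3) = m (x a1) (x a2) (x a3)"
      unfolding x_def by (rule two_point_median[OF mem'(1) mem(5) a])
    moreover have "y (middle b1 b2 b3) = m (y b1) (y b2) (y b3)"
      unfolding y_def by (rule two_point_median[OF mem'(1) mem(6) b])
    moreover have "m (m q' (x a1) (y b1)) (m q' (x a2) (y b2)) (m q' (x a3) (y b3))
        = m q' (m (x a1) (x a2) (x a3)) (m (y b1) (y b2) (y b3))"
      using square_join_median[OF sq' sq'', of "\<lambda>i. x ([a1,a2,a3] ! i)" "\<lambda>i. y ([b1,b2,b3] ! i)"]
        xI yI by simp
    ultimately show ?thesis unfolding d_def by simp
  qed
  have hom: "h (cube_median (Suc n) s t r) = m (h s) (h t) (h r)"
    if s: "s \<in> cube (Suc n)" and t: "t \<in> cube (Suc n)" and r: "r \<in> cube (Suc n)" for s t r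
  proof -
    let ?m = "cube_median (Suc n) s t r"
    have "?c ?m = cube_median n (?c s) (?c t) (?c r)"
      by (auto simp: cube_median_def fun_eq_iff middle_eq)
    then have "c ?m = m (c s) (c t) (c r)"
      using g cc[OF s] cc[OF t] cc[OF r] unfolding c_def median_preserving_def by simp
    moreover have "d (?m i) (?m n) = m (d (s i) (s n)) (d (t i) (t n)) (d (r i) (r n))"
      using d_hom[of "s i" "t i" "r i" "s n" "t n" "r n"] cube_val[OF s] cube_val[OF t] cube_val[OF r] i
      by simp
    moreover have "m (h s) (h t) (h r)
       = m q (m (d (s i) (s n)) (d (t i) (t n)) (d (r i) (r n))) (m (c s) (c t) (c r))"
    proof -
      have "between p (c ([s, t, r] ! j)) e'" if "j < 3" for j :: nat
      proof -
        have "[s, t, r] ! j \<in> cube (Suc n)"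
          using that s t r by (auto simp: less_Suc_eq numeral_3_eq_3)
        then show ?thesis by (rule cI)
      qed
      then show ?thesis
        using square_join_median[OF sq, of "\<lambda>j. d (([s, t, r] ! j) i) (([s, t, r] ! j) n)"
            "\<lambda>j. c ([s, t, r] ! j)"] dI
        unfolding h_def by simp
    qed
    ultimately show ?thesis unfolding h_def by simp
  qed
  have sqf: "between e' p e" "between e' q e" "between w p' z" "between w q' z"
    using sq(1,2)[THEN between_sym] sq'[THEN between_sym] by auto
  have inj_h: "inj_on h (cube (Suc n))"
  proof (rule inj_onI)
    fix s t assume s: "s \<in> cube (Suc n)" and t: "t \<in> cube (Suc n)" and eq: "h s = h t"
    have hd: "proj p e (h s) = d (s i) (s n)" if "s \<in> cube (Suc n)" for s
      unfolding h_def using square_join[OF sq dI cI[OF that]] .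
    have hc: "proj p e' (h s) = c s" if "s \<in> cube (Suc n)" for s
    proof -
      have "proj p e' (m q (c s) (d (s i) (s n))) = c s"
        by (rule square_join[OF sqf(1,2) sq(4,3) cI[OF that] dI])
      then show ?thesis unfolding h_def
        using swap23[of q "c s" "d (s i) (s n)"] mem between_mem[OF dI] between_mem[OF cI[OF that]] by simp
    qed
    have dx: "proj p' z (d a b) = x a" for a b
      unfolding d_def using square_join[OF sq' sq'' xI yI] .
    have dy: "proj p' w (d a b) = y b" for a b
    proof -
      have "proj p' w (m q' (y b) (x a)) = y b"
        by (rule square_join[OF sqf(3,4) sq''(2,1) yI xI])
      then show ?thesis unfolding d_def using swap23[of q' "x a" "y b"] mem' xA yA by simp
    qed
    have "d (s i) (s n) = d (t i) (t n)" using hd[OF s] hd[OF t] eq by simp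
    then have "x (s i) = x (t i)" "y (s n) = y (t n)" using dx dy by metis+
    then have si: "s i = t i" and sn: "s n = t n"
      using cube_val[OF s, of i] cube_val[OF t, of i] cube_val[OF s, of n] cube_val[OF t, of n] i p'z p'w
      unfolding x_def y_def by (auto split: if_splits)
    have "c s = c t" using hc[OF s] hc[OF t] eq by simp
    then have cst: "?c s = ?c t" using inj cc[OF s] cc[OF t] unfolding c_def inj_on_def by simp
    show "s = t"
    proof (rule cube_eqI[OF s t])
      fix j assume j: "j < Suc n"
      consider "j = n" | "j = i" | "j < n" "j \<noteq> i" using j by linarith
      then show "s j = t j"
      proof cases
        case 3
        then show ?thesis using fun_cong[OF cst, of j] by simp
      qed (use si sn in auto)
    qed
  qed
  have "median_preserving (cube (Suc n)) (cube_median (Suc n)) A m h"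
    using hom hA unfolding median_preserving_def by (simp add: Pi_def)
  then show False using not inj_h unfolding cube_embeds_def by simp
qed

lemma chain_median_preserving:
  fixes f :: "'a \<Rightarrow> real"
  assumes chain: "\<And>z w. \<lbrakk>between p z e; between p w e\<rbrakk> \<Longrightarrow> between p z w \<or> between p w z"
    and mono: "\<And>z w. between p z w \<Longrightarrow> f z \<le> f w"
    and pe: "p \<in> A" "e \<in> A"
    and xyz: "between p x e" "between p y e" "between p z e"
  shows "f (m x y z) = middle (f x) (f y) (f z)"
proof -
  have sorted: "m x y z = y" "f x \<le> f y" "f y \<le> f z" if "between p x y" "between p y z" for x y z
  proof -
    have "between x y z" using between_trans(2)[OF that(2,1)] .
    then show "m x y z = y" unfolding between_def by simp
  qed (use that[THEN mono] in simp_all)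
  have sorted': "f (m x y z) = middle (f x) (f y) (f z)" if "between p x y" "between p y z" for x y z
    using sorted(1)[OF that] middle_eq[OF sorted(2,3)[OF that]] by simp
  have mem: "x \<in> A" "y \<in> A" "z \<in> A" using xyz between_mem by auto
  have *: "m x z y = m x y z" "m y x z = m x y z" "m y z x = m x y z" "m z x y = m x y z" "m z y x = m x y z"
    using swap23[of x z y] swap12[of y x z] rot[of x y z] rot[of z x y] swap13[of z y x] mem by auto
  have **: "middle (f x) (f z) (f y) = middle (f x) (f y) (f z)" "middle (f y) (f x) (f z) = middle (f x) (f y) (f z)"
    "middle (f y) (f z) (f x) = middle (f x) (f y) (f z)" "middle (f z) (f x) (f y) = middle (f x) (f y) (f z)"
    "middle (f z) (f y) (f x) = middle (f x) (f y) (f z)"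
    by (auto simp: middle_def min.commute max.commute max.left_commute)
  show ?thesis
    using chain[OF xyz(1,2)] chain[OF xyz(2,3)] chain[OF xyz(1,3)]
      sorted'[of x y z] sorted'[of x z y] sorted'[of y x z] sorted'[of y z x] sorted'[of z x y] sorted'[of z y x]
    unfolding * ** by blast
qed

end

section \<open>Continuous maps to the unit interval\<close>

context topological_median_algebra
begin

lemma continuous_map_median:
  assumes "continuous_map Y X f" "continuous_map Y X g" "continuous_map Y X h"
  shows "continuous_map Y X (\<lambda>x. m (f x) (g x) (h x))"
proof -
  have "continuous_map Y (prod_topology X (prod_topology X X)) (\<lambda>x. (f x, g x, h x))"
    by (intro continuous_map_pairedI assms)
  from continuous_map_compose[OF this continuous_median] show ?thesis
    by (simp add: comp_def)
qed

definition running_max :: "'a \<Rightarrow> ('a \<Rightarrow> real) \<Rightarrow> 'a \<Rightarrow> real" where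
  "running_max p h z = (SUP w\<in>topspace X. h (m p w z))"

context
  fixes p :: 'a and h :: "'a \<Rightarrow> real"
  assumes compact: "compact_space X" and p: "p \<in> topspace X"
    and h: "continuous_map X euclideanreal h"
begin

lemma running_max_attained:
  assumes z: "z \<in> topspace X"
  shows "\<exists>w\<in>topspace X. running_max p h z = h (m p w z) \<and> (\<forall>v\<in>topspace X. h (m p v z) \<le> h (m p w z))"
proof -
  let ?f = "\<lambda>w. h (m p w z)"
  have "continuous_map X X (\<lambda>w. m p w z)"
    by (intro continuous_map_median continuous_map_const[THEN iffD2] continuous_map_id[unfolded id_def])
      (use p z in auto)
  from continuous_map_compose[OF this h] have "continuous_map X euclideanreal ?f"
    by (simp add: comp_def)
  then have "compactin euclideanreal (?f ` topspace X)"
    using compact image_compactin compact_space_def by metis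
  then have "compact (?f ` topspace X)" by simp
  moreover have "?f ` topspace X \<noteq> {}" using p by auto
  ultimately obtain y where y: "y \<in> ?f ` topspace X" "\<forall>t\<in>?f ` topspace X. t \<le> y"
    using compact_attains_sup by metis
  then have "running_max p h z = y"
    unfolding running_max_def by (intro cSup_eq_maximum) auto
  then show ?thesis using y by auto
qed

lemma le_running_max: "\<lbrakk>z \<in> topspace X; v \<in> topspace X\<rbrakk> \<Longrightarrow> h (m p v z) \<le> running_max p h z"
  using running_max_attained by fastforce

lemma continuous_running_max: "continuous_map X euclideanreal (running_max p h)"
  unfolding continuous_map_upper_lower_semicontinuous_le
proof (intro conjI allI)
  fix a :: real
  let ?J = "\<lambda>x. h (m p (fst x) (snd x))"
  have "continuous_map (prod_topology X X) X (\<lambda>x. m p (fst x) (snd x))"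
    by (intro continuous_map_median continuous_map_const[THEN iffD2] continuous_map_fst continuous_map_snd)
      (use p in auto)
  from continuous_map_compose[OF this h] have J: "continuous_map (prod_topology X X) euclideanreal ?J"
    by (simp add: comp_def)
  have "closedin (prod_topology X X) {x \<in> topspace (prod_topology X X). ?J x \<in> {a..}}"
    by (rule closedin_continuous_map_preimage[OF J]) simp
  then have "closedin X (snd ` {x \<in> topspace (prod_topology X X). ?J x \<in> {a..}})"
    using Abstract_Topological_Spaces.closed_map_snd[OF compact] unfolding closed_map_def by blast
  moreover have "{z \<in> topspace X. a \<le> running_max p h z} = snd ` {x \<in> topspace (prod_topology X X). ?J x \<in> {a..}}"
  proof (intro equalityI subsetI)
    fix z assume "z \<in> {z \<in> topspace X. a \<le> running_max p h z}"
    then have z: "z \<in> topspace X" "a \<le> running_max p h z" by auto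
    obtain w where "w \<in> topspace X" "running_max p h z = h (m p w z)"
      using running_max_attained[OF z(1)] by blast
    then have "(w, z) \<in> {x \<in> topspace (prod_topology X X). ?J x \<in> {a..}}" using z by simp
    then show "z \<in> snd ` {x \<in> topspace (prod_topology X X). ?J x \<in> {a..}}" by (rule rev_image_eqI) simp
  next
    fix z assume "z \<in> snd ` {x \<in> topspace (prod_topology X X). ?J x \<in> {a..}}"
    then obtain w where w: "w \<in> topspace X" "z \<in> topspace X" "a \<le> h (m p w z)" by auto
    then show "z \<in> {z \<in> topspace X. a \<le> running_max p h z}"
      using le_running_max[OF w(2,1)] by simp
  qed
  ultimately show "closedin X {z \<in> topspace X. a \<le> running_max p h z}" by simp
next
  fix a :: real
  have "closedin X {z \<in> topspace X. h (m p w z) \<in> {..a}}" if w: "w \<in> topspace X" for w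
  proof (rule closedin_continuous_map_preimage)
    have "continuous_map X X (\<lambda>z. m p w z)"
      by (intro continuous_map_median continuous_map_const[THEN iffD2] continuous_map_id[unfolded id_def])
        (use p w in auto)
    from continuous_map_compose[OF this h] show "continuous_map X euclideanreal (\<lambda>z. h (m p w z))"
      by (simp add: comp_def)
  qed simp
  then have "closedin X (\<Inter>w\<in>topspace X. {z \<in> topspace X. h (m p w z) \<in> {..a}})"
    using p by (intro closedin_Inter) auto
  moreover have "{z \<in> topspace X. running_max p h z \<le> a} = (\<Inter>w\<in>topspace X. {z \<in> topspace X. h (m p w z) \<in> {..a}})"
  proof (intro equalityI subsetI)
    fix z assume "z \<in> {z \<in> topspace X. running_max p h z \<le> a}"
    then have z: "z \<in> topspace X" "running_max p h z \<le> a" by auto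
    have "h (m p w z) \<le> a" if "w \<in> topspace X" for w
      using le_running_max[OF z(1) that] z(2) by simp
    then show "z \<in> (\<Inter>w\<in>topspace X. {z \<in> topspace X. h (m p w z) \<in> {..a}})" using z(1) by simp
  next
    fix z assume z: "z \<in> (\<Inter>w\<in>topspace X. {z \<in> topspace X. h (m p w z) \<in> {..a}})"
    then have "z \<in> topspace X" using p by blast
    then obtain w where "w \<in> topspace X" "running_max p h z = h (m p w z)"
      using running_max_attained by blast
    then show "z \<in> {z \<in> topspace X. running_max p h z \<le> a}" using z \<open>z \<in> topspace X\<close> by simp
  qed
  ultimately show "closedin X {z \<in> topspace X. running_max p h z \<le> a}" by simp
qed

lemma running_max_mono:
  assumes "between p z w"
  shows "running_max p h z \<le> running_max p h w"
proof -
  have mem: "z \<in> topspace X" "w \<in> topspace X" using between_mem[OF assms] by auto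
  obtain v where v: "v \<in> topspace X" "running_max p h z = h (m p v z)"
    using running_max_attained[OF mem(1)] by blast
  have "between p (m p v z) w"
    using between_trans(1)[OF assms between_median(3)[OF p v(1) mem(1)]] .
  then have "m p (m p v z) w = m p v z" "m p v z \<in> topspace X" unfolding between_def by auto
  then show ?thesis using le_running_max[OF mem(2)] v(2) by metis
qed

end

lemma chain_separation:
  assumes compact: "compact_space X"
    and pe: "p \<in> topspace X" "e \<in> topspace X" "p \<noteq> e"
    and chain: "\<And>z w. \<lbrakk>between p z e; between p w e\<rbrakk> \<Longrightarrow> between p z w \<or> between p w z"
  shows "\<exists>f\<in>MC01 X m. \<forall>x\<in>topspace X. (proj p e x = p \<longrightarrow> f x = 0) \<and> (proj p e x = e \<longrightarrow> f x = 1)"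
proof -
  have "closedin X {p}" "closedin X {e}" "disjnt {p} {e}"
    using closedin_Hausdorff_singleton[OF Hausdorff] pe by auto
  then obtain h :: "'a \<Rightarrow> real" where h: "continuous_map X (top_of_set {0..1}) h" "h ` {p} \<subseteq> {0}" "h ` {e} \<subseteq> {1}"
    using Urysohn_lemma[of X "{p}" "{e}" 0 1] compact_Hausdorff_or_regular_imp_normal_space[OF compact] Hausdorff
    by auto
  then have hc: "continuous_map X euclideanreal h" and h01: "\<And>x. x \<in> topspace X \<Longrightarrow> h x \<in> {0..1}"
    by (auto simp: continuous_map_in_subtopology Pi_iff)
  define r where "r = running_max p h"
  note attained = running_max_attained[OF compact pe(1) hc, folded r_def]
  have r01: "r z \<in> {0..1}" if "z \<in> topspace X" for z
    using attained[OF that] h01 closed pe(1) that by fastforce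
  have rp: "r p = 0"
  proof -
    obtain w where "w \<in> topspace X" "r p = h (m p w p)" using attained[OF pe(1)] by blast
    moreover have "m p w p = p" if "w \<in> topspace X" for w
      using swap12[of p w p] absorb[of w p] pe(1) that by simp
    ultimately show ?thesis using h(2) by simp
  qed
  have re: "r e = 1"
  proof -
    have "h (m p e e) \<le> r e"
      using le_running_max[OF compact pe(1) hc pe(2,2)] unfolding r_def .
    then have "1 \<le> r e" using absorb[OF pe(1,2)] h(3) by simp
    then show ?thesis using r01[OF pe(2)] by simp
  qed
  define f where "f = restrict (\<lambda>x. r (proj p e x)) (topspace X)"
  have proj_c: "continuous_map X X (proj p e)"
  proof -
    have "continuous_map X X (\<lambda>x. m p x e)"
      by (intro continuous_map_median continuous_map_const[THEN iffD2] continuous_map_id[unfolded id_def])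
        (use pe in auto)
    then show ?thesis unfolding proj_def[abs_def] .
  qed
  from continuous_map_compose[OF proj_c continuous_running_max[OF compact pe(1) hc]]
  have "continuous_map X euclideanreal (\<lambda>x. r (proj p e x))" by (simp add: comp_def r_def)
  then have "continuous_map X euclideanreal f"
    by (rule continuous_map_eq) (simp add: f_def)
  moreover have f01: "f \<in> topspace X \<rightarrow> {0..1}"
    using r01 proj_closed[OF pe(1,2)] unfolding f_def by simp
  ultimately have "continuous_map X (top_of_set {0..1}) f"
    by (simp add: continuous_map_in_subtopology)
  moreover have "median_preserving (topspace X) m (topspace (top_of_set {0..1})) middle f"
    unfolding median_preserving_def
  proof (intro conjI ballI)
    show "f \<in> topspace X \<rightarrow> topspace (top_of_set {0..1})" using f01 by simp
    fix x y z assume xyz: "x \<in> topspace X" "y \<in> topspace X" "z \<in> topspace X"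
    have "r (m (proj p e x) (proj p e y) (proj p e z))
        = middle (r (proj p e x)) (r (proj p e y)) (r (proj p e z))"
      by (rule chain_median_preserving[OF chain _ pe(1,2)])
        (use running_max_mono[OF compact pe(1) hc] proj_between[OF pe(1,2)] xyz in \<open>simp_all add: r_def\<close>)
    then show "f (m x y z) = middle (f x) (f y) (f z)"
      using xyz closed[OF xyz] proj_median[OF pe(1,2) xyz] unfolding f_def by simp
  qed
  ultimately have "f \<in> MC01 X m" unfolding MC_def f_def by simp
  then show ?thesis using rp re by (intro bexI[of _ f]) (auto simp: f_def)
qed

lemma independent_seq_of_maximal_cube:
  assumes compact: "compact_space X"
    and n: "cube_embeds n (topspace X) m" "\<not> cube_embeds (Suc n) (topspace X) m"
  shows "\<exists>f. (\<forall>i\<in>{1..n}. f i \<in> MC01 X m) \<and> independent_seq (topspace X) n f"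
proof -
  obtain g where g: "median_preserving (cube n) (cube_median n) (topspace X) m g" and inj: "inj_on g (cube n)"
    using n(1) unfolding cube_embeds_def by blast
  define bt where "bt = restrict (\<lambda>_. 0::nat) {..<n}"
  define ed where "ed = (\<lambda>i. restrict (\<lambda>j. if j = i then 1 else 0::nat) {..<n})"
  have bt: "bt \<in> cube n" unfolding bt_def by (rule restrict_in_cube) simp
  have ed: "ed i \<in> cube n" for i unfolding ed_def by (rule restrict_in_cube) simp
  have gX: "g s \<in> topspace X" if "s \<in> cube n" for s using g that unfolding median_preserving_def by blast
  have "\<exists>f\<in>MC01 X m. \<forall>x\<in>topspace X. (proj (g bt) (g (ed i)) x = g bt \<longrightarrow> f x = 0)
      \<and> (proj (g bt) (g (ed i)) x = g (ed i) \<longrightarrow> f x = 1)" if i: "i < n" for i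
  proof (rule chain_separation[OF compact gX[OF bt] gX[OF ed]])
    have "bt i \<noteq> ed i i" using i by (simp add: bt_def ed_def)
    then have "bt \<noteq> ed i" by metis
    then show "g bt \<noteq> g (ed i)" using inj bt ed unfolding inj_on_def by metis
    show "between (g bt) z w \<or> between (g bt) w z"
      if "between (g bt) z (g (ed i))" "between (g bt) w (g (ed i))" for z w
      using cube_edge_chain[OF g inj n(2) i _ _ that] unfolding bt_def ed_def by simp
  qed
  then obtain F where F: "\<And>i. i < n \<Longrightarrow> F i \<in> MC01 X m"
    "\<And>i x. \<lbrakk>i < n; x \<in> topspace X; proj (g bt) (g (ed i)) x = g bt\<rbrakk> \<Longrightarrow> F i x = 0"
    "\<And>i x. \<lbrakk>i < n; x \<in> topspace X; proj (g bt) (g (ed i)) x = g (ed i)\<rbrakk> \<Longrightarrow> F i x = 1"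
    by metis
  have proj_g: "proj (g bt) (g (ed i)) (g s) = g (if s i = 0 then bt else ed i)"
    if s: "s \<in> cube n" and i: "i < n" for s i
  proof -
    have "proj (g bt) (g (ed i)) (g s) = g (cube_median n bt s (ed i))"
      unfolding proj_def using g bt s ed unfolding median_preserving_def by simp
    also have "cube_median n bt s (ed i) = (if s i = 0 then bt else ed i)"
    proof (rule cube_eqI)
      fix j assume j: "j < n"
      then show "cube_median n bt s (ed i) j = (if s i = 0 then bt else ed i) j"
        using cube_val[OF s j] cube_val[OF s i] by (auto simp: bt_def ed_def middle_def)
    qed (use bt s ed cube_median_closed in auto)
    finally show ?thesis .
  qed
  have "independent_seq (topspace X) n (\<lambda>i. F (i - 1))"
    unfolding independent_seq_def
  proof (intro exI conjI allI impI)
    show "(0::real) < 1" by simp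
    fix P M assume PM: "P \<subseteq> {1..n} \<and> M \<subseteq> {1..n} \<and> P \<inter> M = {}"
    define s where "s = restrict (\<lambda>j. if Suc j \<in> M then 1 else 0::nat) {..<n}"
    have s: "s \<in> cube n" unfolding s_def by (rule restrict_in_cube) simp
    have "F (i - 1) (g s) \<le> 0" if "i \<in> P" for i
    proof -
      have "i \<in> {1..n}" "i \<notin> M" using PM that by blast+
      then have i: "i - 1 < n" "Suc (i - 1) = i" "i \<notin> M" by auto
      then have "s (i - 1) = 0" unfolding s_def by simp
      then show ?thesis using F(2)[OF i(1) gX[OF s]] proj_g[OF s i(1)] by simp
    qed
    moreover have "1 \<le> F (i - 1) (g s)" if "i \<in> M" for i
    proof -
      have "i \<in> {1..n}" using PM that by blast
      then have i: "i - 1 < n" "Suc (i - 1) = i" by auto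
      then have "s (i - 1) = 1" unfolding s_def using that by simp
      then show ?thesis using F(3)[OF i(1) gX[OF s]] proj_g[OF s i(1)] by simp
    qed
    ultimately have "g s \<in> topspace X \<inter> (\<Inter>i\<in>P. F (i - 1) -` {..0}) \<inter> (\<Inter>j\<in>M. F (j - 1) -` {1..})"
      using gX[OF s] by simp
    then show "topspace X \<inter> (\<Inter>i\<in>P. F (i - 1) -` {..0}) \<inter> (\<Inter>j\<in>M. F (j - 1) -` {1..}) \<noteq> {}" by blast
  qed
  moreover have "\<forall>i\<in>{1..n}. F (i - 1) \<in> MC01 X m"
  proof
    fix i assume "i \<in> {1..n}"
    then have "i - 1 < n" by auto
    then show "F (i - 1) \<in> MC01 X m" by (rule F(1))
  qed
  ultimately show ?thesis by (intro exI[of _ "\<lambda>i. F (i - 1)"]) simp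
qed

end

theorem theorem3p3:
  fixes X :: "'a topology" and m :: "'a \<Rightarrow> 'a \<Rightarrow> 'a \<Rightarrow> 'a"
  assumes "topological_median_algebra X m"
  shows "ind (topspace X) (MC01 X m) \<le> median_rank (topspace X) m \<and>
    (compact_space X \<and> median_rank (topspace X) m < \<infinity> \<longrightarrow>
       ind (topspace X) (MC01 X m) = median_rank (topspace X) m)"
proof -
  interpret topological_median_algebra X m by fact
  let ?E = "{n. cube_embeds n (topspace X) m}"
  let ?K = "{k. \<exists>f. (\<forall>i\<in>{1..k}. f i \<in> MC01 X m) \<and> independent_seq (topspace X) k f}"
  have KE: "?K \<subseteq> ?E"
  proof
    fix k assume "k \<in> ?K"
    then obtain f where f: "\<forall>i\<in>{1..k}. f i \<in> MC01 X m" "independent_seq (topspace X) k f" by blast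
    have "median_preserving (topspace X) m (topspace (top_of_set {0..1})) middle (f i)"
      if "i \<in> {1..k}" for i
      using f(1) that unfolding MC_def by blast
    then have "cube_embeds k (topspace X) m"
      using f(2) by (rule cube_embeds_if_independent[OF median_algebra_axioms])
    then show "k \<in> ?E" by simp
  qed
  then have le: "ind (topspace X) (MC01 X m) \<le> median_rank (topspace X) m"
    unfolding ind_def median_rank_def by (intro Sup_subset_mono image_mono)
  have "median_rank (topspace X) m \<le> ind (topspace X) (MC01 X m)"
    if compact: "compact_space X" and fin: "median_rank (topspace X) m < \<infinity>"
  proof -
    obtain N where N: "median_rank (topspace X) m = enat N" using fin by auto
    have bound: "n \<le> N" if "cube_embeds n (topspace X) m" for n
    proof -
      have "enat n \<le> median_rank (topspace X) m"
        unfolding median_rank_def by (rule Sup_upper) (use that in simp)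
      then show ?thesis using N by simp
    qed
    show ?thesis
    proof (cases "cube_embeds N (topspace X) m")
      case True
      moreover have "\<not> cube_embeds (Suc N) (topspace X) m" using bound by fastforce
      ultimately have "N \<in> ?K" using independent_seq_of_maximal_cube[OF compact] by simp
      then show ?thesis unfolding N ind_def by (intro Sup_upper imageI)
    next
      case False
      have "median_rank (topspace X) m \<le> enat (N - 1)"
        unfolding median_rank_def
      proof (rule Sup_least)
        fix k assume "k \<in> enat ` ?E"
        then obtain n where n: "k = enat n" "cube_embeds n (topspace X) m" by blast
        then have "n \<noteq> N" "n \<le> N" using False bound by auto
        then show "k \<le> enat (N - 1)" using n(1) by simp
      qed
      then have "N = 0" using N by simp
      then show ?thesis using N by (simp flip: zero_enat_def)
    qed
  qed
  then show ?thesis using le by (metis order.antisym)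
qed

end
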